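(* Let $m\in\mathbb N$. For every $\epsilon\in(0,\epsilon^*]$ and $u_0^{\epsilon,m}\in B^m_{r^*}$, the truncated system $u_n^{\epsilon,m}=u_{n-1}^{\epsilon,m}+\epsilon F_mu_n^{\epsilon,m}$ has a unique solution $u_n^{\epsilon,m}\in B^m_{r^*}$ for every $n\in\mathbb N$. Furthermore, the solution semigroup possesses a unique finite-dimensional numerical attractor (truncated numerical attractor) $\mathcal A^\epsilon_m$, given by $$\mathcal A_m^\epsilon=\bigcap_{N=1}^\infty\overline{\bigcup_{n=N}^\infty u_n^{\epsilon,m}(B^m_{r^*})}.$$
   Context: Parameters: $\alpha,\beta,\nu,\lambda>0$, $\gamma\in(0,1)$, $f=(f_i)_{i\in\mathbb Z}\in\ell^2$ with $\|f\|=(\sum_i f_i^2)^{1/2}$. Constants: $\lambda^*=4\nu+\frac{(2\alpha+\beta+\beta\gamma)^2}{4\beta}-\beta\gamma$, with standing assumption $\lambda>\lambda^*$; for $r>0$, $M_r=\beta r^3+(2\alpha+\beta+\beta\gamma)r^2+(4\nu+\beta\gamma+\lambda)r+\|f\|$, $L_r=4\nu+2\sqrt5\,r\alpha+\sqrt{12r^2(1+\gamma)^2+27r^4+3\gamma^2}\,\beta+\lambda$; $r^*=1+\frac{\|f\|}{\lambda-\lambda^*}$; $\epsilon^*=\min\left(\frac1{M_{r^*+1}},\frac1{1+L_{r^*+1}}\right)$. $\mathbb R^{2m+1}$ has coordinates indexed by $|i|\le m$ and Euclidean norm $\|\cdot\|$; $B^m_r$ is the closed ball of radius $r$ about $0$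 in it. $D_m^-$ is the $(2m+1)\times(2m+1)$ matrix with $-1$ on the diagonal, $1$ on the first subdiagonal and $0$ elsewhere, i.e. $(D_m^-z)_{-m}=-z_{-m}$ and $(D_m^-z)_i=z_{i-1}-z_i$ for $-m<i\le m$. $D_m^+$ is its transpose and $\Lambda_m=D_m^+D_m^-$, i.e. the tridiagonal matrix with off-diagonal entries $-1$ and diagonal entries $2,\dots,2,1$ (the last diagonal entry, for $i=m$, being $1$). $f^m=(f_i)_{|i|\le m}$. Products of vectors are componentwise, and $F_mz=\nu\Lambda_mz-\alpha zD_m^-z+\beta z(1-z)(z-\gamma)-\lambda z+f^m$. $u_n^{\epsilon,m}(y)$ denotes the solution with initial value $y\in B^m_{r^*}$. A numerical attractor of the solution semigroup is a compact set $\mathcal A\subset B^m_{r^*}$ with $u_n^{\epsilon,m}(\mathcal A)=\mathcal A$ for all $n\in\mathbb N$ and $\lim_{n\to\infty}\sup_{y\in B^m_{r^*}}\inf_{a\in\mathcal A}\|u_n^{\epsilon,m}(y)-a\|=0$. *)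

theory Defs
  imports "HOL-Analysis.Analysis"
begin

definition l2_norm :: "(int \<Rightarrow> real) \<Rightarrow> real" where
  "l2_norm f = sqrt (\<Sum>\<^sub>\<infinity>i. (f i)\<^sup>2)"

definition lambda_star :: "real \<Rightarrow> real \<Rightarrow> real \<Rightarrow> real \<Rightarrow> real" where
  "lambda_star \<alpha> \<beta> \<gamma> \<nu> = 4 * \<nu> + (2 * \<alpha> + \<beta> + \<beta> * \<gamma>)\<^sup>2 / (4 * \<beta>) - \<beta> * \<gamma>"

definition M_const ::
  "real \<Rightarrow> real \<Rightarrow> real \<Rightarrow> real \<Rightarrow> real \<Rightarrow> (int \<Rightarrow> real) \<Rightarrow> real \<Rightarrow> real" where
  "M_const \<alpha> \<beta> \<gamma> \<nu> lam f r =
     \<beta> * r ^ 3 + (2 * \<alpha> + \<beta> + \<beta> * \<gamma>) * r\<^sup>2 + (4 * \<nu> + \<beta> * \<gamma> + lam) * r + l2_norm f"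

definition L_const :: "real \<Rightarrow> real \<Rightarrow> real \<Rightarrow> real \<Rightarrow> real \<Rightarrow> real \<Rightarrow> real" where
  "L_const \<alpha> \<beta> \<gamma> \<nu> lam r =
     4 * \<nu> + 2 * sqrt 5 * r * \<alpha>
     + sqrt (12 * r\<^sup>2 * (1 + \<gamma>)\<^sup>2 + 27 * r ^ 4 + 3 * \<gamma>\<^sup>2) * \<beta> + lam"

definition r_star ::
  "real \<Rightarrow> real \<Rightarrow> real \<Rightarrow> real \<Rightarrow> real \<Rightarrow> (int \<Rightarrow> real) \<Rightarrow> real" where
  "r_star \<alpha> \<beta> \<gamma> \<nu> lam f = 1 + l2_norm f / (lam - lambda_star \<alpha> \<beta> \<gamma> \<nu>)"

definition eps_star ::
  "real \<Rightarrow> real \<Rightarrow> real \<Rightarrow> real \<Rightarrow> real \<Rightarrow> (int \<Rightarrow> real) \<Rightarrow> real" where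
  "eps_star \<alpha> \<beta> \<gamma> \<nu> lam f =
     (let r = r_star \<alpha> \<beta> \<gamma> \<nu> lam f + 1
      in min (1 / M_const \<alpha> \<beta> \<gamma> \<nu> lam f r) (1 / (1 + L_const \<alpha> \<beta> \<gamma> \<nu> lam r)))"

text \<open>
  The space of vectors indexed by the integers of absolute value at most \<open>m\<close> is the type
  \<open>real ^ 'n\<close> together with a labelling \<open>e\<close>, a bijection from \<open>'n\<close> onto \<open>{- int m..int m}\<close>:
  the component \<open>z $ i\<close> is the coordinate with integer index \<open>e i\<close>. The norm of \<open>real ^ 'n\<close>
  is the Euclidean one and does not depend on \<open>e\<close>.
\<close>

definition trunc_vec :: "('n::finite \<Rightarrow> int) \<Rightarrow> (int \<Rightarrow> real) \<Rightarrow> real ^ 'n" where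
  "trunc_vec e f = (\<chi> i. f (e i))"

definition D_minus :: "('n::finite \<Rightarrow> int) \<Rightarrow> real ^ 'n ^ 'n" where
  "D_minus e = (\<chi> i j. if e j = e i then - 1 else if e j = e i - 1 then 1 else 0)"

definition D_plus :: "('n::finite \<Rightarrow> int) \<Rightarrow> real ^ 'n ^ 'n" where
  "D_plus e = transpose (D_minus e)"

definition Lambda_mat :: "('n::finite \<Rightarrow> int) \<Rightarrow> real ^ 'n ^ 'n" where
  "Lambda_mat e = D_plus e ** D_minus e"

text \<open>Here \<open>*\<close> and \<open>1\<close> on \<open>real ^ 'n\<close> are the componentwise product and the all-ones vector.\<close>

definition F_trunc ::
  "('n::finite \<Rightarrow> int) \<Rightarrow> real \<Rightarrow> real \<Rightarrow> real \<Rightarrow> real \<Rightarrow> real \<Rightarrow> (int \<Rightarrow> real) \<Rightarrow> real ^ 'n \<Rightarrow> real ^ 'n"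
where
  "F_trunc e \<alpha> \<beta> \<gamma> \<nu> lam f z =
     \<nu> *\<^sub>R (Lambda_mat e *v z) - \<alpha> *\<^sub>R (z * (D_minus e *v z))
     + \<beta> *\<^sub>R (z * (1 - z) * (z - vec \<gamma>)) - lam *\<^sub>R z + trunc_vec e f"

definition implicit_euler_solution ::
  "('a::real_normed_vector \<Rightarrow> 'a) \<Rightarrow> real \<Rightarrow> 'a set \<Rightarrow> 'a \<Rightarrow> (nat \<Rightarrow> 'a) \<Rightarrow> bool" where
  "implicit_euler_solution F \<epsilon> B y u \<longleftrightarrow>
     u 0 = y \<and> (\<forall>n\<ge>1. u n \<in> B \<and> u n = u (n - 1) + \<epsilon> *\<^sub>R F (u n))"

text \<open>The value at \<open>n\<close> of the solution in \<open>B\<close> starting at \<open>y\<close>; meaningful only where that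
  solution exists and is unique.\<close>

definition implicit_euler_flow ::
  "('a::real_normed_vector \<Rightarrow> 'a) \<Rightarrow> real \<Rightarrow> 'a set \<Rightarrow> nat \<Rightarrow> 'a \<Rightarrow> 'a" where
  "implicit_euler_flow F \<epsilon> B n y = (THE u. implicit_euler_solution F \<epsilon> B y u) n"

text \<open>The Hausdorff semidistance is taken in the extended reals, so that the infimum over an
  empty set is infinite and the empty set is not an attractor of a nonempty \<open>B\<close>.\<close>

definition numerical_attractor ::
  "(nat \<Rightarrow> 'a::real_normed_vector \<Rightarrow> 'a) \<Rightarrow> 'a set \<Rightarrow> 'a set \<Rightarrow> bool" where
  "numerical_attractor S B A \<longleftrightarrow>
     compact A \<and> A \<subseteq> B \<and> (\<forall>n. S n ` A = A) \<and>
     (\<lambda>n. SUP y\<in>B. INF a\<in>A. ereal (norm (S n y - a))) \<longlonglongrightarrow> 0"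

end

theory Submission
  imports Defs
begin

text \<open>Bounding \<open>-\<alpha> \<langle>z D\<^sup>-z, z\<rangle>\<close> by the cubic sum \<open>2\<alpha> \<Sum> \<bar>z\<^sub>i\<bar>\<^sup>3\<close> and completing the square against
  the quartic damping gives \<open>\<langle>F z, z\<rangle> \<le> -(\<lambda> - \<lambda>\<^sup>*) \<parallel>z\<parallel>\<^sup>2 + \<parallel>f\<parallel> \<parallel>z\<parallel>\<close>. Hence the implicit step, which is
  solvable by contraction, maps the ball of radius \<open>r\<^sup>*\<close> into itself, and it is continuous there.
  The attractor is the intersection of the nested compact images of that ball. Two attractors
  attract each other, which forces them to be equal.\<close>

section \<open>Attractors of iterated maps\<close>

text \<open>Invariance writes a point of \<open>A'\<close> as \<open>S n y\<close> with
  \<open>y\<close> in \<open>B\<close> for every \<open>n\<close>, so its distance to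
  \<open>A\<close> is below the semidistance at all times, hence zero; compactness makes
  \<open>A\<close> closed. Exchanging the roles gives uniqueness.\<close>

lemma numerical_attractor_subset:
  fixes S :: "nat \<Rightarrow> 'a::real_normed_vector \<Rightarrow> 'a"
  assumes A: "numerical_attractor S B A" and A': "numerical_attractor S B A'"
  shows "A' \<subseteq> A"
proof
  fix a assume a: "a \<in> A'"
  let ?d = "\<lambda>n. SUP y\<in>B. INF b\<in>A. ereal (norm (S n y - b))"
  have "(INF b\<in>A. ereal (norm (a - b))) \<le> ?d n" for n
  proof -
    from a A' obtain y where "y \<in> B" "a = S n y"
      unfolding numerical_attractor_def by blast
    then show ?thesis by (auto intro: SUP_upper)
  qed
  moreover have "?d \<longlonglongrightarrow> 0" using A unfolding numerical_attractor_def by blast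
  ultimately have le0: "(INF b\<in>A. ereal (norm (a - b))) \<le> 0"
    by (meson LIMSEQ_le_const)
  have "\<exists>b\<in>A. dist b a < r" if "r > 0" for r
  proof -
    have "(INF b\<in>A. ereal (norm (a - b))) < ereal r"
      using le0 that by (metis ereal_less(2) order_le_less_trans)
    then show ?thesis by (auto simp: INF_less_iff dist_norm norm_minus_commute)
  qed
  then have "a \<in> closure A" by (simp add: closure_approachable)
  then show "a \<in> A"
    using A by (simp add: numerical_attractor_def compact_imp_closed)
qed

text \<open>The points of \<open>K n\<close> at distance at least \<open>r\<close> from the
  intersection form nested compact sets. Were all of them nonempty, a common point would lie in the
  intersection and yet be at positive distance from it.\<close>

lemma compact_nest_near_Inter:
  fixes K :: "nat \<Rightarrow> 'a::heine_borel set"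
  assumes cpt: "\<And>n. compact (K n)" and ne: "\<And>n. K n \<noteq> {}"
    and mono: "\<And>m n. m \<le> n \<Longrightarrow> K n \<subseteq> K m" and "r > 0"
  obtains N where "\<And>n x. n \<ge> N \<Longrightarrow> x \<in> K n \<Longrightarrow> \<exists>a\<in>\<Inter>(range K). dist x a < r"
proof -
  let ?A = "\<Inter>(range K)"
  \<comment> \<open>\<open>infdist\<close> to the empty set is 0 by convention, so nonemptiness is
    what turns a small \<open>infdist\<close> into an actual nearby point.\<close>
  have Ane: "?A \<noteq> {}" by (rule compact_nest[OF cpt ne mono])
  let ?G = "\<lambda>n. K n \<inter> {x. r \<le> infdist x ?A}"
  have "closed {x. r \<le> infdist x ?A}"
    by (intro closed_Collect_le continuous_intros)
  then have G: "compact (?G n)" for n using cpt by (simp add: compact_Int_closed)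
  have "\<exists>n. ?G n = {}"
  proof (rule ccontr)
    assume *: "\<not> ?thesis"
    have "\<Inter>(range ?G) \<noteq> {}"
      by (rule compact_nest[OF G]) (use * mono in blast)+
    then obtain x where "x \<in> ?A" "r \<le> infdist x ?A" by auto
    then show False using \<open>r > 0\<close> by simp
  qed
  then obtain N where N: "?G N = {}" by blast
  have "\<exists>a\<in>?A. dist x a < r" if "n \<ge> N" "x \<in> K n" for n x
  proof -
    have "infdist x ?A < r" using N mono[OF that(1)] that(2) by force
    then have "(INF a\<in>?A. dist x a) < r" using Ane by (simp add: infdist_def)
    then show ?thesis using Ane by (subst (asm) cINF_less_iff) auto
  qed
  then show thesis using that by blast
qed

lemma image_Inter_compact_nest:
  fixes K :: "nat \<Rightarrow> 'a::heine_borel set" and R :: "'a \<Rightarrow> 'b::t1_space"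
  assumes cpt: "\<And>n. compact (K n)" and mono: "\<And>m n. m \<le> n \<Longrightarrow> K n \<subseteq> K m"
    and cont: "continuous_on (K 0) R"
  shows "R ` \<Inter>(range K) = (\<Inter>n. R ` K n)"
proof
  show "(\<Inter>n. R ` K n) \<subseteq> R ` \<Inter>(range K)"
  proof
    fix x assume x: "x \<in> (\<Inter>n. R ` K n)"
    let ?G = "\<lambda>n. {y \<in> K n. R y = x}"
    have "continuous_on (K n) R" for n
      using cont mono continuous_on_subset by blast
    then have "closed (K n \<inter> R -` {x})" for n
      by (intro continuous_closed_preimage) (auto simp: cpt compact_imp_closed)
    moreover have "K n \<inter> R -` {x} = ?G n" for n by auto
    ultimately have "compact (?G n)" for n
      using cpt[of n] by (metis (no_types, lifting) compact_Int_closed inf.left_idem)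
    moreover have "?G n \<noteq> {}" for n using x by auto
    moreover have "?G n \<subseteq> ?G m" if "m \<le> n" for m n using mono[OF that] by auto
    ultimately have "\<Inter>(range ?G) \<noteq> {}" by (rule compact_nest)
    then obtain y where "\<And>n. y \<in> ?G n" by auto
    then show "x \<in> R ` \<Inter>(range K)" by auto
  qed
qed auto

text \<open>Since \<open>R\<close> maps \<open>B\<close> into itself, the iterated images
  \<open>K n\<close> decrease. Each tail union is therefore its first member, already closed, and
  the limit set is a plain intersection of nonempty compact sets.\<close>

lemma numerical_attractor_iterates:
  fixes R :: "'a::{real_normed_vector,heine_borel} \<Rightarrow> 'a"
  assumes B: "compact B" "B \<noteq> {}" and R: "continuous_on B R" "R ` B \<subseteq> B"
    and S: "\<And>n y. y \<in> B \<Longrightarrow> S n y = (R ^^ n) y"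
  shows "numerical_attractor S B (\<Inter>N\<in>{1..}. closure (\<Union>n\<in>{N..}. S n ` B))"
proof -
  define K where "K n = (R ^^ n) ` B" for n
  have KSuc: "K (Suc n) = R ` K n" for n by (auto simp: K_def)
  have Kdec: "K (Suc n) \<subseteq> K n" for n
    by (induction n) (use R(2) in \<open>auto simp: KSuc K_def\<close>)
  have mono: "K n \<subseteq> K m" if "m \<le> n" for m n
    using that by (rule lift_Suc_antimono_le[rotated]) (rule Kdec)
  have K0: "K 0 = B" by (simp add: K_def)
  have KB: "K n \<subseteq> B" for n using mono[of 0 n] K0 by simp
  have cpt: "compact (K n)" for n
  proof (induction n)
    case (Suc n)
    then show ?case unfolding KSuc
      using R(1) KB continuous_on_subset compact_continuous_image by blast
  qed (simp add: K0 B)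
  have ne: "K n \<noteq> {}" for n using B by (simp add: K_def)
  define A where "A = \<Inter>(range K)"
  have SK: "S n ` B = K n" for n by (simp add: K_def S)
  have "(\<Union>n\<in>{N..}. S n ` B) = K N" for N
    using mono by (auto simp: SK)
  then have "(\<Inter>N\<in>{1..}. closure (\<Union>n\<in>{N..}. S n ` B)) = (\<Inter>N\<in>{1..}. K N)"
    by (simp add: cpt compact_imp_closed)
  \<comment> \<open>The limit set starts at index 1 and \<open>A\<close> at index 0;
    \<open>K 1 \<subseteq> K 0\<close> reconciles them.\<close>
  also have "\<dots> = A"
  proof -
    have "x \<in> K n" if "\<forall>N\<ge>1. x \<in> K N" for x n
      using that Kdec[of n] by (cases n) auto
    then show ?thesis by (auto simp: A_def)
  qed
  finally have omega: "(\<Inter>N\<in>{1..}. closure (\<Union>n\<in>{N..}. S n ` B)) = A" .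
  have cptA: "compact A" unfolding A_def
    by (rule compact_Inter) (auto simp: cpt)
  have AB: "A \<subseteq> B" using K0 by (auto simp: A_def)
  have "R ` A = (\<Inter>n. K (Suc n))"
    unfolding A_def KSuc by (rule image_Inter_compact_nest[OF cpt mono]) (simp_all add: K0 R)
  also have "\<dots> = A" using Kdec by (auto simp: A_def)
  finally have RA: "R ` A = A" .
  have "(R ^^ n) ` A = A" for n
  proof (induction n)
    case (Suc n)
    have "(R ^^ Suc n) ` A = R ` (R ^^ n) ` A" by (auto simp: image_comp)
    then show ?case using Suc RA by simp
  qed simp
  moreover have "S n ` A = (R ^^ n) ` A" for n
    using AB S by (intro image_cong) auto
  ultimately have SA: "S n ` A = A" for n by simp
  let ?d = "\<lambda>n. SUP y\<in>B. INF a\<in>A. ereal (norm (S n y - a))"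
  have "?d \<longlonglongrightarrow> 0"
  proof (rule order_tendstoI)
    fix c :: ereal assume "c < 0"
    \<comment> \<open>A point of \<open>B\<close> is needed because the supremum over the empty set
      in \<open>ereal\<close> is minus infinity.\<close>
    obtain y where "y \<in> B" using B by auto
    have "0 \<le> ?d n" for n
      by (rule SUP_upper2[OF \<open>y \<in> B\<close>], rule INF_greatest) simp
    then show "eventually (\<lambda>n. c < ?d n) sequentially"
      using \<open>c < 0\<close> by (simp add: order_less_le_trans)
  next
    fix c :: ereal assume "0 < c"
    \<comment> \<open>A real strictly between 0 and \<open>c\<close>: pointwise strict bounds by
      \<open>r\<close> give only \<open>\<le> r\<close> for the supremum, which is still
      \<open>< c\<close>.\<close>
    then obtain r where r: "0 < ereal r" "ereal r < c" using ereal_dense2 by blast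
    then have "r > 0" by simp
    obtain N where N: "\<And>n x. n \<ge> N \<Longrightarrow> x \<in> K n \<Longrightarrow> \<exists>a\<in>\<Inter>(range K). dist x a < r"
      by (rule compact_nest_near_Inter[OF cpt ne mono \<open>r > 0\<close>]) auto
    have "?d n \<le> ereal r" if n: "n \<ge> N" for n
    proof (rule SUP_least)
      fix y assume "y \<in> B"
      then have "S n y \<in> K n" using SK by blast
      then obtain a where "a \<in> A" "dist (S n y) a < r" using N[OF n] A_def by blast
      then show "(INF a\<in>A. ereal (norm (S n y - a))) \<le> ereal r"
        by (intro INF_lower2[of a]) (auto simp: dist_norm)
    qed
    then show "eventually (\<lambda>n. ?d n < c) sequentially"
      using r(2) unfolding eventually_sequentially by (meson order_le_less_trans)
  qed
  then show ?thesis
    unfolding omega numerical_attractor_def using cptA AB SA by blast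
qed

section \<open>The implicit Euler scheme of a dissipative vector field\<close>

text \<open>The contraction principle is applied on the larger ball of radius \<open>r + 1\<close>: the map
  \<open>z \<mapsto> y + \<epsilon> F z\<close> preserves it because \<open>\<parallel>y\<parallel> \<le> r\<close> and \<open>\<parallel>\<epsilon> F z\<parallel> \<le> \<epsilon> M \<le> 1\<close>. Dissipativity
  then confines the fixed point to the ball of radius \<open>r\<close>.\<close>

lemma implicit_step_ex1:
  fixes F :: "'a::euclidean_space \<Rightarrow> 'a"
  assumes "0 < \<epsilon>" and "0 \<le> L" and "0 < \<kappa>" and "0 < r" and "\<rho> \<le> \<kappa> * r"
    and "\<epsilon> * M \<le> 1" and "\<epsilon> * L < 1"
    and bound: "\<And>z. norm z \<le> r + 1 \<Longrightarrow> norm (F z) \<le> M"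
    and lip: "\<And>z w. norm z \<le> r + 1 \<Longrightarrow> norm w \<le> r + 1 \<Longrightarrow> norm (F z - F w) \<le> L * norm (z - w)"
    and diss: "\<And>z. F z \<bullet> z \<le> - \<kappa> * (norm z)\<^sup>2 + \<rho> * norm z"
    and y: "y \<in> cball 0 r"
  shows "\<exists>!z. z \<in> cball 0 r \<and> z = y + \<epsilon> *\<^sub>R F z"
proof -
  have "\<exists>!z\<in>cball 0 (r + 1). y + \<epsilon> *\<^sub>R F z = z"
  proof (rule Banach_fix)
    show "complete (cball 0 (r + 1) :: 'a set)" by (simp add: compact_imp_complete)
    show "cball 0 (r + 1) \<noteq> ({} :: 'a set)" using \<open>0 < r\<close> by simp
    show "0 \<le> \<epsilon> * L" using \<open>0 < \<epsilon>\<close> \<open>0 \<le> L\<close> by simp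
    show "\<epsilon> * L < 1" by fact
    show "(\<lambda>z. y + \<epsilon> *\<^sub>R F z) ` cball 0 (r + 1) \<subseteq> cball 0 (r + 1)"
    proof clarsimp
      fix z :: 'a assume "norm z \<le> r + 1"
      then have "\<epsilon> * norm (F z) \<le> \<epsilon> * M"
        using bound \<open>0 < \<epsilon>\<close> by simp
      then have "norm (\<epsilon> *\<^sub>R F z) \<le> 1"
        using order_trans[OF _ \<open>\<epsilon> * M \<le> 1\<close>] \<open>0 < \<epsilon>\<close> by simp
      then show "norm (y + \<epsilon> *\<^sub>R F z) \<le> r + 1"
        using y norm_triangle_ineq[of y "\<epsilon> *\<^sub>R F z"] by simp
    qed
    fix z w :: 'a assume zw: "z \<in> cball 0 (r + 1)" "w \<in> cball 0 (r + 1)"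
    have "dist (y + \<epsilon> *\<^sub>R F z) (y + \<epsilon> *\<^sub>R F w) = \<epsilon> * norm (F z - F w)"
      using \<open>0 < \<epsilon>\<close> by (simp add: dist_norm flip: scaleR_diff_right)
    also have "\<dots> \<le> \<epsilon> * (L * norm (z - w))"
      using lip zw \<open>0 < \<epsilon>\<close> by simp
    finally show "dist (y + \<epsilon> *\<^sub>R F z) (y + \<epsilon> *\<^sub>R F w) \<le> \<epsilon> * L * dist z w"
      by (simp add: dist_norm mult.assoc)
  qed
  then obtain z where z: "y + \<epsilon> *\<^sub>R F z = z"
    and uniq: "\<And>w. norm w \<le> r + 1 \<Longrightarrow> y + \<epsilon> *\<^sub>R F w = w \<Longrightarrow> w = z"
    by (metis mem_cball_0)
  have "norm z \<le> r" if z: "y + \<epsilon> *\<^sub>R F z = z" for z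
  proof (rule ccontr)
    assume c: "\<not> norm z \<le> r"
    \<comment> \<open>Pairing the implicit equation with \<open>z\<close> and inserting
      dissipativity leaves \<open>(1 + \<epsilon> * \<kappa>) * (norm z * (norm z - r)) \<le>
      0\<close>, impossible outside the ball.\<close>
    have "(norm z)\<^sup>2 = (y + \<epsilon> *\<^sub>R F z) \<bullet> z" by (simp add: z power2_norm_eq_inner)
    also have "\<dots> = y \<bullet> z + \<epsilon> * (F z \<bullet> z)" by (simp add: inner_add_left)
    also have "\<dots> \<le> r * norm z + \<epsilon> * (- \<kappa> * (norm z)\<^sup>2 + \<kappa> * r * norm z)"
    proof (intro add_mono mult_left_mono)
      show "y \<bullet> z \<le> r * norm z"
        using norm_cauchy_schwarz[of y z] y mult_right_mono[of "norm y" r "norm z"] by simp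
      show "F z \<bullet> z \<le> - \<kappa> * (norm z)\<^sup>2 + \<kappa> * r * norm z"
        using diss[of z] mult_right_mono[OF \<open>\<rho> \<le> \<kappa> * r\<close>, of "norm z"] by simp
    qed (use \<open>0 < \<epsilon>\<close> in simp)
    finally have "(1 + \<epsilon> * \<kappa>) * (norm z * (norm z - r)) \<le> 0"
      by (simp add: algebra_simps power2_eq_square)
    moreover have "(1 + \<epsilon> * \<kappa>) * (norm z * (norm z - r)) > 0"
      using c \<open>0 < r\<close> \<open>0 < \<epsilon>\<close> \<open>0 < \<kappa>\<close> by (intro mult_pos_pos add_pos_pos) auto
    ultimately show False by simp
  qed
  \<comment> \<open>Uniqueness in the small ball is inherited from uniqueness in the larger
    one.\<close>
  from this[OF z] z show ?thesis
    by (intro ex1I[of _ z]) (auto intro: uniq)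
qed

text \<open>Subtracting two implicit equations bounds \<open>norm (R x - R y)\<close> by
  \<open>norm (x - y)\<close> plus \<open>\<epsilon> * L\<close> times itself; as
  \<open>\<epsilon> * L < 1\<close>, that term is absorbed on the left.\<close>

lemma implicit_step_continuous_on:
  fixes F :: "'a::real_normed_vector \<Rightarrow> 'a"
  assumes "0 < \<epsilon>" "\<epsilon> * L < 1"
    and lip: "\<And>z w. z \<in> B \<Longrightarrow> w \<in> B \<Longrightarrow> norm (F z - F w) \<le> L * norm (z - w)"
    and R: "\<And>y. y \<in> B \<Longrightarrow> R y \<in> B \<and> R y = y + \<epsilon> *\<^sub>R F (R y)"
  shows "continuous_on B R"
proof -
  have "norm (R x - R y) \<le> 1 / (1 - \<epsilon> * L) * norm (x - y)" if "x \<in> B" "y \<in> B" for x y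
  proof -
    have "R x - R y = (x - y) + \<epsilon> *\<^sub>R (F (R x) - F (R y))"
      using R that by (smt (verit) add_diff_add scaleR_diff_right)
    then have "norm (R x - R y) \<le> norm (x - y) + norm (\<epsilon> *\<^sub>R (F (R x) - F (R y)))"
      by (metis norm_triangle_ineq)
    also have "\<dots> \<le> norm (x - y) + \<epsilon> * (L * norm (R x - R y))"
      using lip R that \<open>0 < \<epsilon>\<close> by simp
    finally show ?thesis using \<open>\<epsilon> * L < 1\<close> by (simp add: field_simps)
  qed
  then have "(1 / (1 - \<epsilon> * L))-lipschitz_on B R"
    using \<open>\<epsilon> * L < 1\<close> by (intro lipschitz_onI) (auto simp: dist_norm)
  then show ?thesis by (rule lipschitz_on_continuous_on)
qed

text \<open>Unique solvability of one step turns the implicit scheme into an explicit recursion.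
  Every iterate stays in \<open>B\<close>, so the hypothesis on \<open>R\<close> applies again at
  the next step.\<close>

lemma implicit_euler_solution_iff:
  assumes R: "\<And>y z. y \<in> B \<Longrightarrow> z \<in> B \<and> z = y + \<epsilon> *\<^sub>R F z \<longleftrightarrow> z = R y"
    and y: "y \<in> B"
  shows "implicit_euler_solution F \<epsilon> B y u \<longleftrightarrow> u = (\<lambda>n. (R ^^ n) y)"
proof
  have RB: "(R ^^ n) y \<in> B" for n
    by (induction n) (use R y in auto)
  assume u: "implicit_euler_solution F \<epsilon> B y u"
  have "u n = (R ^^ n) y" for n
  proof (induction n)
    case (Suc n)
    have "u (Suc n) \<in> B \<and> u (Suc n) = u n + \<epsilon> *\<^sub>R F (u (Suc n))"
      using u unfolding implicit_euler_solution_def by (metis diff_Suc_1 le_add1 plus_1_eq_Suc)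
    then show ?case using R[of "u n" "u (Suc n)"] RB Suc by simp
  qed (use u in \<open>simp add: implicit_euler_solution_def\<close>)
  then show "u = (\<lambda>n. (R ^^ n) y)" by auto
next
  have RB: "(R ^^ n) y \<in> B" for n
    by (induction n) (use R y in auto)
  assume u: "u = (\<lambda>n. (R ^^ n) y)"
  have "u n \<in> B \<and> u n = u (n - 1) + \<epsilon> *\<^sub>R F (u n)" if n: "n \<ge> 1" for n
  proof -
    obtain k where k: "n = Suc k" using n by (cases n) auto
    then show ?thesis using R[OF RB[of k], of "u n"] u by simp
  qed
  then show "implicit_euler_solution F \<epsilon> B y u"
    by (simp add: implicit_euler_solution_def u)
qed

lemma implicit_euler_attractor:
  fixes F :: "'a::euclidean_space \<Rightarrow> 'a"
  assumes B: "compact B" "B \<noteq> {}" and "0 < \<epsilon>" "\<epsilon> * L < 1"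
    and lip: "\<And>z w. z \<in> B \<Longrightarrow> w \<in> B \<Longrightarrow> norm (F z - F w) \<le> L * norm (z - w)"
    and step: "\<And>y. y \<in> B \<Longrightarrow> \<exists>!z. z \<in> B \<and> z = y + \<epsilon> *\<^sub>R F z"
  shows "\<forall>y\<in>B. \<exists>!u. implicit_euler_solution F \<epsilon> B y u"
    and "numerical_attractor (implicit_euler_flow F \<epsilon> B) B
      (\<Inter>N\<in>{1..}. closure (\<Union>n\<in>{N..}. implicit_euler_flow F \<epsilon> B n ` B))"
proof -
  \<comment> \<open>The one-step solution operator, that is the inverse of
    \<open>z - \<epsilon> F z\<close> restricted to \<open>B\<close>; the flow at time
    \<open>n\<close> is its \<open>n\<close>-th iterate.\<close>
  define R where "R y = (THE z. z \<in> B \<and> z = y + \<epsilon> *\<^sub>R F z)" for y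
  have R: "R y \<in> B \<and> R y = y + \<epsilon> *\<^sub>R F (R y)" if "y \<in> B" for y
    unfolding R_def by (rule theI'[OF step[OF that]])
  have R_iff: "z \<in> B \<and> z = y + \<epsilon> *\<^sub>R F z \<longleftrightarrow> z = R y" if "y \<in> B" for y z
    using step[OF that] R[OF that] by blast
  note sol = implicit_euler_solution_iff[where R = R, OF R_iff]
  show "\<forall>y\<in>B. \<exists>!u. implicit_euler_solution F \<epsilon> B y u"
    by (simp add: sol)
  show "numerical_attractor (implicit_euler_flow F \<epsilon> B) B
      (\<Inter>N\<in>{1..}. closure (\<Union>n\<in>{N..}. implicit_euler_flow F \<epsilon> B n ` B))"
  proof (rule numerical_attractor_iterates[OF B])
    show "continuous_on B R"
      by (rule implicit_step_continuous_on[OF \<open>0 < \<epsilon>\<close> \<open>\<epsilon> * L < 1\<close> lip R])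
    show "R ` B \<subseteq> B" using R by auto
    show "implicit_euler_flow F \<epsilon> B n y = (R ^^ n) y" if "y \<in> B" for n y
      by (simp add: implicit_euler_flow_def sol that)
  qed
qed

section \<open>Estimates for the truncated vector field\<close>

text \<open>For injective \<open>e\<close> the sum has at most one term. At the left end it is empty
  and gives 0, matching the first row of \<open>D_minus\<close>, which has only its diagonal
  entry.\<close>

definition shift_vec :: "('n::finite \<Rightarrow> int) \<Rightarrow> real ^ 'n \<Rightarrow> real ^ 'n" where
  "shift_vec e z = (\<chi> i. \<Sum>j | e j = e i - 1. z $ j)"

lemma D_minus_mult_vec:
  assumes "inj e"
  shows "D_minus e *v z = shift_vec e z - z"
proof -
  have "(D_minus e *v z) $ i = (shift_vec e z - z) $ i" for i
  proof -
    have "(D_minus e *v z) $ i =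
        (\<Sum>j\<in>UNIV. (if e j = e i - 1 then z $ j else 0) - (if j = i then z $ j else 0))"
      unfolding matrix_vector_mult_def D_minus_def
      using assms by (auto intro!: sum.cong simp: inj_eq)
    also have "\<dots> = (shift_vec e z - z) $ i"
      by (simp add: sum_subtractf shift_vec_def sum.If_cases)
    finally show ?thesis .
  qed
  then show ?thesis by (simp add: vec_eq_iff)
qed

text \<open>The shift moves each component to at most one place and fills the gap with 0, where
  \<open>g\<close> vanishes. It is used for squares (norms) and for cubes of absolute values
  (convection).\<close>

lemma sum_shift_vec_le:
  fixes g :: "real \<Rightarrow> real"
  assumes "inj e" and g: "\<And>x. g x \<ge> 0" "g 0 = 0"
  shows "(\<Sum>i\<in>UNIV. g (shift_vec e z $ i)) \<le> (\<Sum>i\<in>UNIV. g (z $ i))"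
proof -
  have single: "g (shift_vec e z $ i) = (\<Sum>j | e j = e i - 1. g (z $ j))" for i
  proof (cases "\<exists>j. e j = e i - 1")
    case True
    then obtain k where k: "e k = e i - 1" by blast
    then have "{j. e j = e i - 1} = {k}" using assms(1) by (auto simp: inj_def)
    then show ?thesis by (simp add: shift_vec_def)
  next
    case False
    then have "{j. e j = e i - 1} = {}" by auto
    then show ?thesis by (simp add: shift_vec_def g)
  qed
  have "(\<Sum>i\<in>UNIV. g (shift_vec e z $ i)) = (\<Sum>i\<in>UNIV. \<Sum>j\<in>UNIV. if e j = e i - 1 then g (z $ j) else 0)"
    by (simp add: single sum.If_cases)
  \<comment> \<open>After exchanging the sums, the weight of \<open>g (z $ j)\<close> counts the
    right neighbours of \<open>j\<close>, at most one by injectivity.\<close>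
  also have "\<dots> = (\<Sum>j\<in>UNIV. \<Sum>i\<in>UNIV. if e j = e i - 1 then g (z $ j) else 0)"
    by (rule sum.swap)
  also have "\<dots> = (\<Sum>j\<in>UNIV. real (card {i. e j = e i - 1}) * g (z $ j))"
    by (simp add: sum.If_cases)
  also have "\<dots> \<le> (\<Sum>j\<in>UNIV. 1 * g (z $ j))"
  proof (intro sum_mono mult_right_mono g)
    fix j
    have "card {i. e j = e i - 1} \<le> 1"
      using assms(1) by (auto simp: card_le_Suc0_iff_eq inj_def)
    then show "real (card {i. e j = e i - 1}) \<le> 1" by simp
  qed
  finally show ?thesis by simp
qed

lemma norm_D_minus_le:
  assumes "inj e"
  shows "norm (D_minus e *v z) \<le> 2 * norm z"
proof -
  have "(norm (shift_vec e z))\<^sup>2 \<le> (norm z)\<^sup>2"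
    unfolding power2_norm_eq_inner inner_vec_def
    using sum_shift_vec_le[OF assms, of "\<lambda>x. x\<^sup>2" z] by (simp add: power2_eq_square)
  then have "norm (shift_vec e z) \<le> norm z" by (rule power2_le_imp_le) simp
  then show ?thesis
    unfolding D_minus_mult_vec[OF assms] using norm_triangle_ineq4[of "shift_vec e z" z] by simp
qed

text \<open>Moving the transpose across the inner product gives
  \<open>?x \<bullet> ?x = (?D *v z) \<bullet> (?D *v ?x)\<close>, so the bound 2 for
  \<open>D_minus\<close> is used twice and the transpose needs no estimate of its own.\<close>

lemma norm_Lambda_mat_le:
  assumes "inj e"
  shows "norm (Lambda_mat e *v z) \<le> 4 * norm z"
proof -
  let ?D = "D_minus e" let ?x = "Lambda_mat e *v z"
  have "?x = (?D *v z) v* ?D"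
    by (simp add: Lambda_mat_def D_plus_def flip: matrix_vector_mul_assoc)
  then have "?x \<bullet> ?x = (?D *v z) \<bullet> (?D *v ?x)" by (metis dot_lmul_matrix)
  also have "\<dots> \<le> norm (?D *v z) * norm (?D *v ?x)" by (rule norm_cauchy_schwarz)
  also have "\<dots> \<le> (2 * norm z) * (2 * norm ?x)"
    by (intro mult_mono norm_D_minus_le assms) auto
  finally have "norm ?x * norm ?x \<le> 4 * norm z * norm ?x"
    by (simp add: power2_norm_eq_inner[symmetric] power2_eq_square)
  then show ?thesis by (cases "norm ?x = 0") (auto simp: mult_le_cancel_right)
qed

section \<open>Componentwise products, forcing and the cubic term\<close>

lemma norm_le_scaled_componentwise:
  fixes z w :: "real ^ 'n"
  assumes "\<And>i. \<bar>w $ i\<bar> \<le> c * \<bar>z $ i\<bar>" and "0 \<le> c"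
  shows "norm w \<le> c * norm z"
proof -
  have "norm w \<le> norm (c *\<^sub>R z)"
    using assms by (intro norm_le_componentwise_cart) (simp add: abs_mult)
  then show ?thesis using assms(2) by simp
qed

lemma norm_mult_vec_le:
  fixes z w :: "real ^ 'n"
  shows "norm (z * w) \<le> norm z * norm w"
proof (rule norm_le_scaled_componentwise)
  show "\<bar>(z * w) $ i\<bar> \<le> norm z * \<bar>w $ i\<bar>" for i
    unfolding vector_mult_component abs_mult
    by (rule mult_right_mono[OF component_le_norm_cart]) simp
qed simp

lemma norm_trunc_vec_le:
  assumes "inj e" and "(\<lambda>i. (f i)\<^sup>2) summable_on UNIV"
  shows "norm (trunc_vec e f) \<le> l2_norm f"
proof -
  have "(\<Sum>i\<in>UNIV. (f (e i))\<^sup>2) = (\<Sum>k\<in>range e. (f k)\<^sup>2)"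
    using assms(1) by (simp add: sum.reindex)
  \<comment> \<open>Summability is essential here: \<open>infsum\<close> of a non-summable family is
    0 by convention.\<close>
  also have "\<dots> \<le> (\<Sum>\<^sub>\<infinity>k. (f k)\<^sup>2)"
    by (rule finite_sum_le_infsum) (use assms(2) in auto)
  finally show ?thesis
    by (simp add: norm_vec_def L2_set_def trunc_vec_def l2_norm_def)
qed

text \<open>Two of the three factors are bounded componentwise by
  \<open>(1 + r) * (r + \<gamma>)\<close>; the third keeps its Euclidean norm, so the bound is
  independent of the dimension.\<close>

lemma norm_cubic_le:
  fixes z :: "real ^ 'n"
  assumes "norm z \<le> r" and "0 < \<gamma>"
  shows "norm (z * (1 - z) * (z - vec \<gamma>)) \<le> r ^ 3 + (1 + \<gamma>) * r\<^sup>2 + \<gamma> * r"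
proof -
  have r: "0 \<le> r" using assms(1) norm_ge_zero order_trans by blast
  have "norm (z * (1 - z) * (z - vec \<gamma>)) \<le> (r\<^sup>2 + (1 + \<gamma>) * r + \<gamma>) * norm z"
  proof (rule norm_le_scaled_componentwise)
    fix i
    have a: "\<bar>z $ i\<bar> \<le> r" using assms(1) by (rule norm_bound_component_le_cart)
    have "\<bar>(1 - z $ i) * (z $ i - \<gamma>)\<bar> \<le> (1 + r) * (r + \<gamma>)"
      unfolding abs_mult using a assms(2) r by (intro mult_mono) auto
    also have "\<dots> = r\<^sup>2 + (1 + \<gamma>) * r + \<gamma>" by (simp add: algebra_simps power2_eq_square)
    finally have "\<bar>(1 - z $ i) * (z $ i - \<gamma>)\<bar> * \<bar>z $ i\<bar> \<le> (r\<^sup>2 + (1 + \<gamma>) * r + \<gamma>) * \<bar>z $ i\<bar>"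
      by (rule mult_right_mono) simp
    then show "\<bar>(z * (1 - z) * (z - vec \<gamma>)) $ i\<bar> \<le> (r\<^sup>2 + (1 + \<gamma>) * r + \<gamma>) * \<bar>z $ i\<bar>"
      by (simp add: abs_mult mult_ac)
  qed (use r assms in auto)
  also have "\<dots> \<le> (r\<^sup>2 + (1 + \<gamma>) * r + \<gamma>) * r"
    using assms r by (intro mult_left_mono) auto
  finally show ?thesis by (simp add: algebra_simps power2_eq_square power3_eq_cube)
qed

lemma norm_cubic_diff_le:
  fixes z w :: "real ^ 'n"
  assumes "norm z \<le> r" "norm w \<le> r" and "0 < \<gamma>"
  shows "norm (z * (1 - z) * (z - vec \<gamma>) - w * (1 - w) * (w - vec \<gamma>))
    \<le> sqrt (12 * r\<^sup>2 * (1 + \<gamma>)\<^sup>2 + 27 * r ^ 4 + 3 * \<gamma>\<^sup>2) * norm (z - w)" (is "_ \<le> ?c * _")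
proof (rule norm_le_scaled_componentwise)
  fix i
  let ?a = "z $ i" let ?b = "w $ i"
  have a: "\<bar>?a\<bar> \<le> r" "\<bar>?b\<bar> \<le> r" using assms by (auto intro: norm_bound_component_le_cart)
  \<comment> \<open>Divided difference of the cubic \<open>s * (1 - s) * (s - \<gamma>)\<close>
    between \<open>?a\<close> and \<open>?b\<close>.\<close>
  define q where "q = (1 + \<gamma>) * (?a + ?b) - (?a\<^sup>2 + ?a * ?b + ?b\<^sup>2) - \<gamma>"
  have sq: "\<bar>?a * ?b\<bar> \<le> r\<^sup>2" "?a\<^sup>2 \<le> r\<^sup>2" "?b\<^sup>2 \<le> r\<^sup>2"
    using mult_mono[OF a] power_mono[OF a(1), of 2] power_mono[OF a(2), of 2] a
    by (simp_all add: abs_mult power2_eq_square)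
  have "\<bar>(1 + \<gamma>) * (?a + ?b)\<bar> \<le> (1 + \<gamma>) * (2 * r)"
    unfolding abs_mult using a assms(3) by (intro mult_mono) auto
  then have q: "\<bar>q\<bar> \<le> 2 * r * (1 + \<gamma>) + 3 * r\<^sup>2 + \<gamma>" (is "_ \<le> ?x + ?y + \<gamma>")
    unfolding q_def using sq assms(3) by (simp add: mult_ac) (smt (verit) zero_le_power2)
  \<comment> \<open>The gap between the two sides is the sum of the squared pairwise differences.
    With \<open>?x = 2 * r * (1 + \<gamma>)\<close> and \<open>?y = 3 * r\<^sup>2\<close>, the
    factor 3 produces the coefficients 12, 27 and 3 of \<open>L_const\<close>.\<close>
  have "(?x + ?y + \<gamma>)\<^sup>2 \<le> 3 * (?x\<^sup>2 + ?y\<^sup>2 + \<gamma>\<^sup>2)"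
    using sum_squares_ge_zero[of "?x - ?y" "?y - \<gamma>"] zero_le_square[of "?x - \<gamma>"]
    by (simp add: algebra_simps power2_eq_square)
  moreover have "3 * (?x\<^sup>2 + ?y\<^sup>2 + \<gamma>\<^sup>2) = 12 * r\<^sup>2 * (1 + \<gamma>)\<^sup>2 + 27 * r ^ 4 + 3 * \<gamma>\<^sup>2"
    by (simp add: algebra_simps power2_eq_square power4_eq_xxxx)
  ultimately have "?x + ?y + \<gamma> \<le> ?c"
    by (intro real_le_rsqrt) simp
  with q have "\<bar>q\<bar> \<le> ?c" by (rule order_trans)
  then have "\<bar>q\<bar> * \<bar>?a - ?b\<bar> \<le> ?c * \<bar>?a - ?b\<bar>" by (rule mult_right_mono) simp
  moreover have "?a * (1 - ?a) * (?a - \<gamma>) - ?b * (1 - ?b) * (?b - \<gamma>) = q * (?a - ?b)"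
    unfolding q_def by (simp add: algebra_simps power2_eq_square)
  ultimately show "\<bar>(z * (1 - z) * (z - vec \<gamma>) - w * (1 - w) * (w - vec \<gamma>)) $ i\<bar> \<le> ?c * \<bar>(z - w) $ i\<bar>"
    by (simp add: abs_mult)
qed simp

section \<open>Growth, Lipschitz and dissipativity estimates\<close>

context
  fixes \<alpha> \<beta> \<gamma> \<nu> lam :: real and f :: "int \<Rightarrow> real" and e :: "'n::finite \<Rightarrow> int"
  assumes pos: "\<alpha> > 0" "\<beta> > 0" "\<nu> > 0" "lam > 0" "0 < \<gamma>"
    and e: "inj e"
begin

lemma norm_F_trunc_le:
  assumes "(\<lambda>i. (f i)\<^sup>2) summable_on UNIV" and "norm z \<le> r"
  shows "norm (F_trunc e \<alpha> \<beta> \<gamma> \<nu> lam f z) \<le> M_const \<alpha> \<beta> \<gamma> \<nu> lam f r"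
proof -
  have r: "0 \<le> r" using assms(2) norm_ge_zero order_trans by blast
  let ?a = "Lambda_mat e *v z" let ?b = "z * (D_minus e *v z)"
  let ?c = "z * (1 - z) * (z - vec \<gamma>)"
  have "norm ?a \<le> 4 * r" using norm_Lambda_mat_le[OF e, of z] assms(2) by simp
  then have a: "\<nu> * norm ?a \<le> \<nu> * (4 * r)" using pos by simp
  have "norm ?b \<le> r * (2 * r)"
    using norm_mult_vec_le[of z "D_minus e *v z"] norm_D_minus_le[OF e, of z] assms(2) r
      mult_mono[of "norm z" r "norm (D_minus e *v z)" "2 * r"] by simp
  then have b: "\<alpha> * norm ?b \<le> \<alpha> * (r * (2 * r))" using pos by simp
  have c: "\<beta> * norm ?c \<le> \<beta> * (r ^ 3 + (1 + \<gamma>) * r\<^sup>2 + \<gamma> * r)"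
    using norm_cubic_le[OF assms(2)] pos by simp
  have d: "lam * norm z \<le> lam * r" using assms(2) pos by simp
  have "norm (F_trunc e \<alpha> \<beta> \<gamma> \<nu> lam f z)
      \<le> norm (\<nu> *\<^sub>R ?a) + norm (\<alpha> *\<^sub>R ?b) + norm (\<beta> *\<^sub>R ?c) + norm (lam *\<^sub>R z) + norm (trunc_vec e f)"
    unfolding F_trunc_def
    by (intro order_trans[OF norm_triangle_ineq] order_trans[OF norm_triangle_ineq4] add_mono order_refl)
  also have "\<dots> \<le> \<nu> * (4 * r) + \<alpha> * (r * (2 * r)) + \<beta> * (r ^ 3 + (1 + \<gamma>) * r\<^sup>2 + \<gamma> * r)
      + lam * r + l2_norm f"
    unfolding norm_scaleR using pos a b c d norm_trunc_vec_le[OF e assms(1)]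
    by (intro add_mono) (simp_all only: abs_of_pos)
  also have "\<dots> = M_const \<alpha> \<beta> \<gamma> \<nu> lam f r"
    by (simp add: M_const_def algebra_simps power2_eq_square)
  finally show ?thesis .
qed

lemma norm_F_trunc_diff_le:
  assumes "norm z \<le> r" "norm w \<le> r"
  shows "norm (F_trunc e \<alpha> \<beta> \<gamma> \<nu> lam f z - F_trunc e \<alpha> \<beta> \<gamma> \<nu> lam f w)
    \<le> L_const \<alpha> \<beta> \<gamma> \<nu> lam r * norm (z - w)"
proof -
  have r: "0 \<le> r" using assms(1) norm_ge_zero order_trans by blast
  let ?D = "D_minus e" let ?n = "norm (z - w)"
  let ?a = "Lambda_mat e *v (z - w)"
  \<comment> \<open>The convection difference split by bilinearity, so that each summand contains
    one factor \<open>z - w\<close>.\<close>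
  let ?b = "z * (?D *v (z - w)) + (z - w) * (?D *v w)"
  let ?c = "z * (1 - z) * (z - vec \<gamma>) - w * (1 - w) * (w - vec \<gamma>)"
  let ?s = "sqrt (12 * r\<^sup>2 * (1 + \<gamma>)\<^sup>2 + 27 * r ^ 4 + 3 * \<gamma>\<^sup>2)"
  have a: "\<nu> * norm ?a \<le> \<nu> * (4 * ?n)" using norm_Lambda_mat_le[OF e, of "z - w"] pos by simp
  have "norm (z * (?D *v (z - w))) \<le> r * (2 * ?n)"
    using norm_mult_vec_le[of z "?D *v (z - w)"] norm_D_minus_le[OF e, of "z - w"] assms(1) r
      mult_mono[of "norm z" r "norm (?D *v (z - w))" "2 * ?n"] by simp
  moreover have "norm ((z - w) * (?D *v w)) \<le> ?n * (2 * r)"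
    using norm_mult_vec_le[of "z - w" "?D *v w"] norm_D_minus_le[OF e, of w] assms(2) r
      mult_left_mono[of "norm (?D *v w)" "2 * r" ?n] by simp
  ultimately have "norm ?b \<le> 4 * r * ?n"
    using norm_triangle_ineq[of "z * (?D *v (z - w))" "(z - w) * (?D *v w)"] by (simp add: mult_ac)
  \<comment> \<open>The splitting gives the constant \<open>4 * r\<close>, relaxed to the
    \<open>2 * sqrt 5 * r\<close> of \<open>L_const\<close>.\<close>
  also have "\<dots> \<le> 2 * sqrt 5 * r * ?n"
  proof -
    have "2 \<le> sqrt 5" by (rule real_le_rsqrt) simp
    then show ?thesis using r by (intro mult_right_mono) auto
  qed
  finally have b: "\<alpha> * norm ?b \<le> \<alpha> * (2 * sqrt 5 * r * ?n)" using pos by simp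
  have c: "\<beta> * norm ?c \<le> \<beta> * (?s * ?n)" using norm_cubic_diff_le[OF assms] pos by simp
  have convection: "z * (?D *v z) - w * (?D *v w) = ?b"
    by (simp add: matrix_vector_mult_diff_distrib algebra_simps)
  have "F_trunc e \<alpha> \<beta> \<gamma> \<nu> lam f z - F_trunc e \<alpha> \<beta> \<gamma> \<nu> lam f w
      = \<nu> *\<^sub>R ?a - \<alpha> *\<^sub>R ?b + \<beta> *\<^sub>R ?c - lam *\<^sub>R (z - w)"
    unfolding convection[symmetric]
    by (simp add: F_trunc_def matrix_vector_mult_diff_distrib scaleR_diff_right)
  also have "norm \<dots> \<le> norm (\<nu> *\<^sub>R ?a) + norm (\<alpha> *\<^sub>R ?b) + norm (\<beta> *\<^sub>R ?c) + norm (lam *\<^sub>R (z - w))"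
    by (intro order_trans[OF norm_triangle_ineq] order_trans[OF norm_triangle_ineq4] add_mono order_refl)
  also have "\<dots> \<le> \<nu> * (4 * ?n) + \<alpha> * (2 * sqrt 5 * r * ?n) + \<beta> * (?s * ?n) + lam * ?n"
    unfolding norm_scaleR using pos a b c
    by (intro add_mono) (simp_all only: abs_of_pos order_refl)
  also have "\<dots> = L_const \<alpha> \<beta> \<gamma> \<nu> lam r * ?n"
    by (simp add: L_const_def algebra_simps)
  finally show ?thesis .
qed

text \<open>Young's inequality \<open>3 a\<^sup>2 b \<le> 2 a\<^sup>3 + b\<^sup>3\<close> decouples the neighbouring components.\<close>

lemma convection_inner_le:
  "- (z * (D_minus e *v z)) \<bullet> z \<le> (\<Sum>i\<in>UNIV. 2 * \<bar>z $ i\<bar> ^ 3)"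
proof -
  let ?s = "shift_vec e z"
  have "- (z * (D_minus e *v z)) \<bullet> z = (\<Sum>i\<in>UNIV. - ((z $ i)\<^sup>2 * (?s $ i - z $ i)))"
    by (simp add: inner_vec_def D_minus_mult_vec[OF e] power2_eq_square mult_ac)
  \<comment> \<open>The coefficient 5/3 is 1 from the component's own cube plus 2/3 from Young; the
    neighbour's 1/3 is shifted back below, for a total of 2.\<close>
  also have "\<dots> \<le> (\<Sum>i\<in>UNIV. 5 / 3 * \<bar>z $ i\<bar> ^ 3 + 1 / 3 * \<bar>?s $ i\<bar> ^ 3)"
  proof (rule sum_mono)
    fix i
    let ?a = "\<bar>z $ i\<bar>" let ?b = "\<bar>?s $ i\<bar>"
    \<comment> \<open>The product expands to
      \<open>2 * ?a ^ 3 - 3 * ?a\<^sup>2 * ?b + ?b ^ 3\<close>, so its sign is Young's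
      inequality.\<close>
    have "0 \<le> (?a - ?b)\<^sup>2 * (2 * ?a + ?b)" by simp
    then have "3 * (?a\<^sup>2 * ?b) \<le> 2 * ?a ^ 3 + ?b ^ 3"
      by (simp add: algebra_simps power2_eq_square power3_eq_cube)
    moreover have "?a\<^sup>2 * (z $ i - ?s $ i) \<le> ?a\<^sup>2 * (?a + ?b)"
      by (rule mult_left_mono) auto
    moreover have "?a\<^sup>2 * (?a + ?b) = ?a ^ 3 + ?a\<^sup>2 * ?b"
      by (simp add: algebra_simps power2_eq_square power3_eq_cube)
    ultimately show "- ((z $ i)\<^sup>2 * (?s $ i - z $ i)) \<le> 5 / 3 * ?a ^ 3 + 1 / 3 * ?b ^ 3"
      by (simp add: algebra_simps)
  qed
  also have "\<dots> \<le> (\<Sum>i\<in>UNIV. 2 * \<bar>z $ i\<bar> ^ 3)"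
    using sum_shift_vec_le[OF e, of "\<lambda>x. \<bar>x\<bar> ^ 3" z]
    unfolding sum.distrib sum_distrib_left[symmetric] by simp
  finally show ?thesis .
qed

text \<open>Convection and reaction together contribute at most \<open>z $ i\<close> squared times a
  concave quadratic in its absolute value. The maximum of that quadratic, plus the
  \<open>4 * \<nu>\<close> from diffusion, is exactly \<open>lambda_star\<close>.\<close>

lemma F_trunc_inner_le:
  assumes "(\<lambda>i. (f i)\<^sup>2) summable_on UNIV"
  shows "F_trunc e \<alpha> \<beta> \<gamma> \<nu> lam f z \<bullet> z
    \<le> - (lam - lambda_star \<alpha> \<beta> \<gamma> \<nu>) * (norm z)\<^sup>2 + l2_norm f * norm z"
proof -
  let ?c = "z * (1 - z) * (z - vec \<gamma>)"
  let ?k = "2 * \<alpha> + \<beta> + \<beta> * \<gamma>"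
  have norm2: "(norm z)\<^sup>2 = (\<Sum>i\<in>UNIV. (z $ i)\<^sup>2)"
    unfolding power2_norm_eq_inner by (simp add: inner_vec_def power2_eq_square)
  have "(Lambda_mat e *v z) \<bullet> z \<le> norm (Lambda_mat e *v z) * norm z"
    by (rule norm_cauchy_schwarz)
  also have "\<dots> \<le> 4 * norm z * norm z"
    by (intro mult_right_mono norm_Lambda_mat_le[OF e]) simp
  finally have a: "\<nu> * ((Lambda_mat e *v z) \<bullet> z) \<le> \<nu> * (4 * (norm z)\<^sup>2)"
    using pos by (simp add: power2_eq_square)
  have "\<alpha> * (- (z * (D_minus e *v z)) \<bullet> z) + \<beta> * (?c \<bullet> z)
      \<le> \<alpha> * (\<Sum>i\<in>UNIV. 2 * \<bar>z $ i\<bar> ^ 3) + \<beta> * (?c \<bullet> z)"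
    using mult_left_mono[OF convection_inner_le, of \<alpha>] pos by simp
  also have "\<dots> = (\<Sum>i\<in>UNIV. 2 * \<alpha> * \<bar>z $ i\<bar> ^ 3 + \<beta> * ((z $ i)\<^sup>2 * (1 - z $ i) * (z $ i - \<gamma>)))"
    by (simp add: inner_vec_def sum.distrib sum_distrib_left power2_eq_square mult_ac)
  also have "\<dots> \<le> (\<Sum>i\<in>UNIV. (?k\<^sup>2 / (4 * \<beta>) - \<beta> * \<gamma>) * (z $ i)\<^sup>2)"
  proof (rule sum_mono)
    fix i
    let ?x = "z $ i" let ?a = "\<bar>z $ i\<bar>"
    have "(1 + \<gamma>) * ?x \<le> (1 + \<gamma>) * ?a" using pos by (intro mult_left_mono) auto
    then have "(1 - ?x) * (?x - \<gamma>) \<le> (1 + \<gamma>) * ?a - ?a\<^sup>2 - \<gamma>"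
      by (simp add: algebra_simps power2_eq_square)
    then have "2 * \<alpha> * ?a + \<beta> * ((1 - ?x) * (?x - \<gamma>))
        \<le> 2 * \<alpha> * ?a + \<beta> * ((1 + \<gamma>) * ?a - ?a\<^sup>2 - \<gamma>)"
      using pos by simp
    also have "\<dots> = ?k * ?a - \<beta> * ?a\<^sup>2 - \<beta> * \<gamma>" by (simp add: algebra_simps)
    also have "\<dots> \<le> ?k\<^sup>2 / (4 * \<beta>) - \<beta> * \<gamma>"
    proof -
      \<comment> \<open>Completing the square; the maximiser is
        \<open>?a = ?k / (2 * \<beta>)\<close>.\<close>
      have "0 \<le> (?k - 2 * \<beta> * ?a)\<^sup>2" by simp
      then have "(?k * ?a - \<beta> * ?a\<^sup>2) * (4 * \<beta>) \<le> ?k\<^sup>2"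
        unfolding power2_diff by (simp add: algebra_simps power2_eq_square)
      then show ?thesis using pos by (simp add: pos_le_divide_eq)
    qed
    finally have "(2 * \<alpha> * ?a + \<beta> * ((1 - ?x) * (?x - \<gamma>))) * ?a\<^sup>2
        \<le> (?k\<^sup>2 / (4 * \<beta>) - \<beta> * \<gamma>) * ?a\<^sup>2"
      by (rule mult_right_mono) simp
    moreover have "(2 * \<alpha> * ?a + \<beta> * ((1 - ?x) * (?x - \<gamma>))) * ?a\<^sup>2
        = 2 * \<alpha> * ?a ^ 3 + \<beta> * (?a\<^sup>2 * (1 - ?x) * (?x - \<gamma>))"
      by (simp only: power2_eq_square power3_eq_cube ring_distribs mult_ac)
    ultimately show "2 * \<alpha> * ?a ^ 3 + \<beta> * (?x\<^sup>2 * (1 - ?x) * (?x - \<gamma>))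
        \<le> (?k\<^sup>2 / (4 * \<beta>) - \<beta> * \<gamma>) * ?x\<^sup>2"
      by simp
  qed
  also have "\<dots> = (?k\<^sup>2 / (4 * \<beta>) - \<beta> * \<gamma>) * (norm z)\<^sup>2"
    by (simp add: norm2 sum_distrib_left)
  finally have bc: "\<alpha> * (- (z * (D_minus e *v z)) \<bullet> z) + \<beta> * (?c \<bullet> z)
      \<le> (?k\<^sup>2 / (4 * \<beta>) - \<beta> * \<gamma>) * (norm z)\<^sup>2" .
  have "trunc_vec e f \<bullet> z \<le> norm (trunc_vec e f) * norm z" by (rule norm_cauchy_schwarz)
  also have "\<dots> \<le> l2_norm f * norm z"
    by (intro mult_right_mono norm_trunc_vec_le[OF e assms]) simp
  finally have d: "trunc_vec e f \<bullet> z \<le> l2_norm f * norm z" .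
  have "F_trunc e \<alpha> \<beta> \<gamma> \<nu> lam f z \<bullet> z = \<nu> * ((Lambda_mat e *v z) \<bullet> z)
      + (\<alpha> * (- (z * (D_minus e *v z)) \<bullet> z) + \<beta> * (?c \<bullet> z)) - lam * (norm z)\<^sup>2 + trunc_vec e f \<bullet> z"
    by (simp add: F_trunc_def inner_add_left inner_diff_left power2_norm_eq_inner)
  also have "\<dots> \<le> \<nu> * (4 * (norm z)\<^sup>2) + (?k\<^sup>2 / (4 * \<beta>) - \<beta> * \<gamma>) * (norm z)\<^sup>2
      - lam * (norm z)\<^sup>2 + l2_norm f * norm z"
    using a bc d by linarith
  also have "\<dots> = - (lam - lambda_star \<alpha> \<beta> \<gamma> \<nu>) * (norm z)\<^sup>2 + l2_norm f * norm z"
    by (simp add: lambda_star_def algebra_simps)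
  finally show ?thesis .
qed

end

section \<open>Existence, uniqueness and the attractor for the truncated system\<close>

theorem theorem4p1:
  fixes \<alpha> \<beta> \<gamma> \<nu> lam \<epsilon> :: real
    and f :: "int \<Rightarrow> real"
    and m :: nat
    and e :: "'n::finite \<Rightarrow> int"
  defines "B \<equiv> cball (0 :: real ^ 'n) (r_star \<alpha> \<beta> \<gamma> \<nu> lam f)"
  defines "F \<equiv> F_trunc e \<alpha> \<beta> \<gamma> \<nu> lam f"
  defines "S \<equiv> implicit_euler_flow F \<epsilon> B"
  defines "\<A> \<equiv> (\<Inter>N\<in>{1..}. closure (\<Union>n\<in>{N..}. S n ` B))"
  assumes "\<alpha> > 0" and "\<beta> > 0" and "\<nu> > 0" and "lam > 0"
    and "0 < \<gamma>" and "\<gamma> < 1"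
    and "(\<lambda>i. (f i)\<^sup>2) summable_on UNIV"
    and "lam > lambda_star \<alpha> \<beta> \<gamma> \<nu>"
    and "bij_betw e UNIV {- int m..int m}"
    and "0 < \<epsilon>" and "\<epsilon> \<le> eps_star \<alpha> \<beta> \<gamma> \<nu> lam f"
  shows "(\<forall>y\<in>B. \<exists>!u. implicit_euler_solution F \<epsilon> B y u)
    \<and> numerical_attractor S B \<A>
    \<and> (\<forall>A. numerical_attractor S B A \<longrightarrow> A = \<A>)"
proof -
  define r where "r = r_star \<alpha> \<beta> \<gamma> \<nu> lam f"
  define \<kappa> where "\<kappa> = lam - lambda_star \<alpha> \<beta> \<gamma> \<nu>"
  \<comment> \<open>Both constants are taken at radius \<open>r + 1\<close>, that of the ball on
    which the contraction principle runs.\<close>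
  define M where "M = M_const \<alpha> \<beta> \<gamma> \<nu> lam f (r + 1)"
  define L where "L = L_const \<alpha> \<beta> \<gamma> \<nu> lam (r + 1)"
  note pos = \<open>\<alpha> > 0\<close> \<open>\<beta> > 0\<close> \<open>\<nu> > 0\<close> \<open>lam > 0\<close> \<open>0 < \<gamma>\<close>
  note summable = \<open>(\<lambda>i. (f i)\<^sup>2) summable_on UNIV\<close>
  have inj: "inj e"
    using \<open>bij_betw e UNIV {- int m..int m}\<close> by (rule bij_betw_imp_inj_on)
  have f0: "0 \<le> l2_norm f" by (simp add: l2_norm_def infsum_nonneg)
  have \<kappa>: "0 < \<kappa>"
    using \<open>lam > lambda_star \<alpha> \<beta> \<gamma> \<nu>\<close> by (simp add: \<kappa>_def)
  have r: "r = 1 + l2_norm f / \<kappa>" by (simp add: r_def r_star_def \<kappa>_def)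
  then have "0 < r" using f0 \<kappa> by (simp add: add_pos_nonneg)
  \<comment> \<open>Here \<open>\<kappa> * r = \<kappa> + l2_norm f\<close>; the summand 1 in
    \<open>r_star\<close> also keeps the radius positive when \<open>f\<close> is zero.\<close>
  have fr: "l2_norm f \<le> \<kappa> * r" using \<kappa> by (simp add: r field_simps)
  have "0 < M" unfolding M_def M_const_def
    using pos f0 \<open>0 < r\<close> by (intro add_pos_nonneg add_pos_pos mult_pos_pos) auto
  have "0 \<le> L" unfolding L_def L_const_def
    using pos \<open>0 < r\<close> by (intro add_nonneg_nonneg mult_nonneg_nonneg) auto
  \<comment> \<open>The first bound keeps the larger ball invariant; the second gives
    \<open>\<epsilon> * L \<le> L / (1 + L)\<close>, hence a strict contraction.\<close>
  have "\<epsilon> \<le> 1 / M" "\<epsilon> \<le> 1 / (1 + L)"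
    using \<open>\<epsilon> \<le> eps_star \<alpha> \<beta> \<gamma> \<nu> lam f\<close> by (auto simp: eps_star_def Let_def M_def L_def r_def)
  then have \<epsilon>M: "\<epsilon> * M \<le> 1" and \<epsilon>L: "\<epsilon> * L < 1"
    using \<open>0 < M\<close> \<open>0 \<le> L\<close> \<open>0 < \<epsilon>\<close> by (auto simp: field_simps)
  have lip: "norm (F z - F w) \<le> L * norm (z - w)" if "norm z \<le> r + 1" "norm w \<le> r + 1" for z w
    unfolding F_def L_def using norm_F_trunc_diff_le[OF pos inj that] .
  have step: "\<exists>!z. z \<in> B \<and> z = y + \<epsilon> *\<^sub>R F z" if "y \<in> B" for y
    unfolding B_def r_def[symmetric]
  proof (rule implicit_step_ex1[OF \<open>0 < \<epsilon>\<close> \<open>0 \<le> L\<close> \<kappa> \<open>0 < r\<close> fr \<epsilon>M \<epsilon>L _ lip])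
    show "norm (F z) \<le> M" if "norm z \<le> r + 1" for z
      unfolding F_def M_def using norm_F_trunc_le[OF pos inj summable that] .
    show "F z \<bullet> z \<le> - \<kappa> * (norm z)\<^sup>2 + l2_norm f * norm z" for z
      unfolding F_def \<kappa>_def using F_trunc_inner_le[OF pos inj summable] .
    show "y \<in> cball 0 r" using that by (simp add: B_def r_def)
  qed
  have B: "compact B" "B \<noteq> {}" using \<open>0 < r\<close> by (auto simp: B_def r_def)
  have lipB: "norm (F z - F w) \<le> L * norm (z - w)" if "z \<in> B" "w \<in> B" for z w
    using that by (intro lip) (auto simp: B_def r_def)
  note main = implicit_euler_attractor[OF B \<open>0 < \<epsilon>\<close> \<epsilon>L lipB step]
  have "numerical_attractor S B \<A>" unfolding S_def \<A>_def using main(2) by blast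
  \<comment> \<open>Both inclusions between two attractors come from the subset lemma with the roles
    exchanged.\<close>
  then show ?thesis using main(1) numerical_attractor_subset by blast
qed

end
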